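(* For all integers $d \ge 3$ and $2 \le k \le d+1$ there exists a constant $C > 0$ (depending on $d$ and $k$) such that for all integers $n \ge k$, $$\Delta_{k,d}(n) \le C\, n^{-\frac12 \log \frac{d+2}{d-k+2}}.$$
   Context: For integers $2 \le k \le d+1$ and $n \ge k$, $\Delta_{k,d}(n)$ denotes the minimum $\Delta > 0$ such that among any $n$ (distinct) points in $[0,1]^d$ there are $k$ points which form a simplex with $(k-1)$-dimensional volume at most $\Delta$ (the simplex is the convex hull of the $k$ points; if it is degenerate its volume is $0$). $\log$ is the natural logarithm. *)

theory Defs
  imports "HOL-Analysis.Analysis"
begin

definition orthonormal_frame :: "nat \<Rightarrow> (nat \<Rightarrow> 'a::euclidean_space) \<Rightarrow> bool" where
  "orthonormal_frame m b \<longleftrightarrow> (\<forall>i<m. \<forall>j<m. b i \<bullet> b j = (if i = j then 1 else 0))"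

definition frame_point :: "nat \<Rightarrow> 'a::euclidean_space \<Rightarrow> (nat \<Rightarrow> 'a) \<Rightarrow> (nat \<Rightarrow> real) \<Rightarrow> 'a" where
  "frame_point m p b x = p + (\<Sum>i<m. x i *\<^sub>R b i)"

text \<open>
  The \<open>m\<close>-dimensional volume of a Borel set \<open>S\<close> lying in some \<open>m\<close>-dimensional flat: identify
  the flat isometrically with \<open>\<real>\<^sup>m\<close> by Cartesian coordinates (origin \<open>p\<close>, orthonormal directions
  \<open>b 0, \<dots>, b (m - 1)\<close>) and take the \<open>m\<close>-dimensional Lebesgue measure of the coordinate set.
  By isometry invariance of Lebesgue measure the value does not depend on the coordinates
  chosen; if \<open>S\<close> lies in several \<open>m\<close>-flats, i.e. in a flat of lower dimension, it is \<open>0\<close>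
  for each of them. The value is unspecified if \<open>S\<close> lies in no \<open>m\<close>-flat; the convex hull of
  \<open>m + 1 \<le> DIM('a) + 1\<close> points always lies in one.
\<close>
definition flat_volume :: "nat \<Rightarrow> 'a::euclidean_space set \<Rightarrow> real" where
  "flat_volume m S =
    (let (p, b) = (SOME (p, b). orthonormal_frame m b \<and> S \<subseteq> range (frame_point m p b))
     in measure (Pi\<^sub>M {..<m} (\<lambda>_. lborel)) {x \<in> {..<m} \<rightarrow>\<^sub>E UNIV. frame_point m p b x \<in> S})"

text \<open>
  The dimension \<open>d\<close> is the cardinality of the index type \<open>'d\<close>, and \<open>cbox 0 1\<close> is the unit cube
  \<open>[0,1]\<^sup>d\<close>. The defining set has a minimum: it is bounded below by \<open>0\<close>, and since an
  \<open>n\<close>-point set has only finitely many \<open>k\<close>-subsets, the infimum again satisfies the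
  condition on point sets; it is positive because there are \<open>n\<close> points in general position.
  So \<open>Inf\<close> is that minimum.
\<close>
definition Delta :: "'d::finite itself \<Rightarrow> nat \<Rightarrow> nat \<Rightarrow> real" where
  "Delta TYPE('d) k n = Inf {\<Delta>. \<Delta> > 0 \<and>
     (\<forall>P :: (real ^ 'd) set. P \<subseteq> cbox 0 1 \<and> card P = n \<longrightarrow>
        (\<exists>S \<subseteq> P. card S = k \<and> flat_volume (k - 1) (convex hull S) \<le> \<Delta>))}"

end

theory Submission imports Defs begin

text \<open>
  The volume of a simplex with vertices \<open>x 0, \<dots>, x m\<close> is at most the product of its heights, the
  distances of the edges \<open>x i - x 0\<close> from the span of the edges before them. Vertices with many small
  heights are found in blocks. Suppose \<open>j\<close> affinely independent points are already chosen. Their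
  edges span \<open>j - 1\<close> dimensions, so after projecting along this span the remaining points live
  in dimension \<open>D = d - (j - 1)\<close>, and by the pigeonhole principle some \<open>s\<close> of them have projections
  at mutual distance \<open>O(n powr (- 1 / D))\<close>. Append these \<open>s\<close> points: the height of the first
  is bounded, and each of the others has height \<open>O(n powr (- 1 / D))\<close>, because its difference to
  the first is that short modulo the earlier edges. A block of \<open>s\<close> points thus improves
  the exponent by \<open>(s - 1) / D\<close> and lowers the free dimension by \<open>s\<close>. Only for the initial block,
  whose first point is the base vertex \<open>x 0\<close>, is no dimension wasted. This is
  \<open>height_chain_extend\<close> and, with constants hidden, \<open>chain_exponent_step\<close>.

  The logarithm arises by telescoping. A block of three at free dimension \<open>D \<ge> 7\<close> yields
  \<open>2 / D \<ge> 1/2 * ln (D / (D - 3))\<close>; blocks of two would narrowly fall short, as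
  \<open>1 / D < 1/2 * ln (D / (D - 2))\<close>. Once at most three vertices are wanted, or the free dimension is
  small, one or two blocks finish (\<open>chain_exponent_fill\<close>). An initial block of four yields
  \<open>3 / d \<ge> 1/2 * ln ((d + 2) / (d - 3))\<close> for \<open>d \<ge> 6\<close>, and for \<open>d \<le> 5\<close> or \<open>k \<le> 4\<close> a single block
  of all \<open>k\<close> vertices, with exponent \<open>(k - 1) / d\<close>, is good enough (\<open>chain_exponent_full\<close>).

  The dimension count needs affine independence. If some \<open>k\<close> of the points are affinely dependent,
  however, they span a simplex of volume \<open>0\<close>, which is as good as it gets.

  The inequality between volume and heights (\<open>flat_volume_simplex_le_prod_heights\<close>) is a determinant
  estimate. The coordinate set of the simplex is multiplied by a cube to make it full-dimensional; the
  product lies in a parallelepiped, whose measure is a determinant, and a determinant is bounded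
  by the distances of its rows from the spans of the earlier rows.
\<close>

section \<open>Lebesgue measure of coordinate cylinders\<close>

lemma emeasure_lborel_coordinate_box:
  fixes A :: "'n::finite \<Rightarrow> real set"
  assumes A: "\<And>i. A i \<in> sets borel"
  shows "emeasure lborel {v :: real ^ 'n. \<forall>i. v $ i \<in> A i} = (\<Prod>i\<in>UNIV. emeasure lborel (A i))"
proof -
  interpret product_sigma_finite "\<lambda>_::real^'n. lborel :: real measure" by standard
  define idx :: "real ^ 'n \<Rightarrow> 'n" where "idx b = (THE i. b = axis i 1)" for b
  have idx: "idx (axis i 1) = i" for i
    by (simp add: idx_def axis_eq_axis)
  have coord: "(\<Sum>b\<in>Basis. f b *\<^sub>R b) $ i = f (axis i 1)" for f :: "real ^ 'n \<Rightarrow> real" and i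
  proof -
    have "(\<Sum>b\<in>Basis. f b *\<^sub>R b) $ i = (\<Sum>b\<in>Basis. f b *\<^sub>R b) \<bullet> axis i 1"
      by (simp add: inner_axis)
    then show ?thesis
      by (simp add: inner_sum_left_Basis axis_in_Basis_iff)
  qed
  have meas: "{v :: real ^ 'n. \<forall>i. v $ i \<in> A i} \<in> sets borel"
  proof -
    have "{v :: real ^ 'n. v $ i \<in> A i} \<in> sets borel" for i
      using measurable_sets[OF borel_measurable_continuous_onI[OF continuous_on_component[OF continuous_on_id]] A, of i i]
      by (simp add: vimage_def)
    then have "(\<Inter>i. {v :: real ^ 'n. v $ i \<in> A i}) \<in> sets borel"
      by (intro sets.finite_INT) auto
    then show ?thesis by (simp add: INTER_eq)
  qed
  have "emeasure lborel {v :: real ^ 'n. \<forall>i. v $ i \<in> A i} =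
    emeasure (\<Pi>\<^sub>M b\<in>(Basis :: (real ^ 'n) set). lborel) (Pi\<^sub>E Basis (\<lambda>b. A (idx b)))"
  proof -
    have "(\<forall>b\<in>Basis. Q b) \<longleftrightarrow> (\<forall>i. Q (axis i 1))" for Q :: "real ^ 'n \<Rightarrow> bool"
      by (auto simp: Basis_vec_def)
    then have "(\<lambda>f. \<Sum>b\<in>Basis. f b *\<^sub>R b) -` {v :: real ^ 'n. \<forall>i. v $ i \<in> A i} \<inter> space (\<Pi>\<^sub>M b\<in>Basis. lborel) =
        Pi\<^sub>E Basis (\<lambda>b. A (idx b))"
      unfolding vimage_def mem_Collect_eq coord by (auto simp: space_PiM PiE_iff idx Basis_vec_def)
    then show ?thesis
      using meas by (subst lborel_eq) (simp add: emeasure_distr)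
  qed
  also have "\<dots> = (\<Prod>b\<in>(Basis :: (real ^ 'n) set). emeasure lborel (A (idx b)))"
    using A by (intro emeasure_PiM) auto
  also have "\<dots> = (\<Prod>i\<in>UNIV. emeasure lborel (A i))"
    by (rule prod.reindex_bij_witness[of _ "\<lambda>i. axis i 1" idx])
       (auto simp: Basis_vec_def idx)
  finally show ?thesis .
qed

text \<open>
  This transfers \<open>m\<close>-dimensional measure to a space \<open>real ^ 'n\<close> of possibly larger dimension, where
  determinants are at hand: the surplus coordinates run through unit intervals and contribute
  a factor \<open>1\<close>. Both sides are measures in \<open>X\<close> that agree on boxes.
\<close>
lemma emeasure_PiM_lborel_eq_cylinder:
  fixes e :: "nat \<Rightarrow> 'n::finite" and m :: nat
  assumes e: "bij_betw e {..<CARD('n)} UNIV" and m: "m \<le> CARD('n)"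
    and X: "X \<in> sets (Pi\<^sub>M {..<m} (\<lambda>_. lborel :: real measure))"
  shows "emeasure (Pi\<^sub>M {..<m} (\<lambda>_. lborel)) X =
    emeasure lborel {v :: real ^ 'n. (\<lambda>i\<in>{..<m}. v $ e i) \<in> X \<and> (\<forall>i\<in>{m..<CARD('n)}. v $ e i \<in> {0..1})}"
    (is "_ = emeasure lborel (?cyl X)")
proof -
  interpret product_sigma_finite "\<lambda>_::nat. lborel :: real measure" by standard
  define D where "D = {v :: real ^ 'n. \<forall>i\<in>{m..<CARD('n)}. v $ e i \<in> {0..1}}"
  define \<psi> where "\<psi> = (\<lambda>v :: real ^ 'n. \<lambda>i\<in>{..<m}. v $ e i)"
  have "closed D"
    unfolding D_def Ball_def atLeastAtMost_iff
    by (intro closed_Collect_all closed_Collect_imp closed_Collect_conj closed_Collect_le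
        open_Collect_const continuous_intros)
  then have D: "D \<in> sets borel" by simp
  have \<psi>: "\<psi> \<in> measurable (restrict_space lborel D) (Pi\<^sub>M {..<m} (\<lambda>_. lborel))"
    unfolding \<psi>_def
    by (intro measurable_restrict measurable_restrict_space1)
       (auto intro!: borel_measurable_continuous_onI continuous_intros)
  define \<nu> where "\<nu> = distr (restrict_space lborel D) (Pi\<^sub>M {..<m} (\<lambda>_. lborel :: real measure)) \<psi>"
  have \<nu>: "emeasure \<nu> Y = emeasure lborel (?cyl Y)" if "Y \<in> sets (Pi\<^sub>M {..<m} (\<lambda>_. lborel))" for Y
  proof -
    have "emeasure \<nu> Y = emeasure (restrict_space lborel D) (\<psi> -` Y \<inter> D)"
      unfolding \<nu>_def using that \<psi> by (simp add: emeasure_distr space_restrict_space)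
    also have "\<dots> = emeasure lborel (\<psi> -` Y \<inter> D)"
      using D by (intro emeasure_restrict_space) auto
    also have "\<psi> -` Y \<inter> D = ?cyl Y"
      unfolding \<psi>_def D_def by blast
    finally show ?thesis .
  qed
  have \<nu>_eq: "\<nu> = Pi\<^sub>M {..<m} (\<lambda>_. lborel)"
  proof (rule PiM_eqI)
    fix A :: "nat \<Rightarrow> real set" assume "\<And>i. i \<in> {..<m} \<Longrightarrow> A i \<in> sets lborel"
    then have A: "A i \<in> sets borel" if "i < m" for i using that by simp
    define B where "B j = (if j < m then A j else {0..1})" for j
    define inv where "inv = the_inv_into {..<CARD('n)} e"
    have inv: "inv (e i) = i" if "i < CARD('n)" for i
      using that e by (simp add: inv_def bij_betw_def the_inv_into_f_f)
    have all: "(\<forall>i. Q i) \<longleftrightarrow> (\<forall>j<CARD('n). Q (e j))" for Q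
      using e unfolding bij_betw_def by (metis UNIV_I imageE lessThan_iff)
    have "emeasure \<nu> (Pi\<^sub>E {..<m} A) = emeasure lborel (?cyl (Pi\<^sub>E {..<m} A))"
      using A by (intro \<nu> sets_PiM_I_finite) auto
    also have "?cyl (Pi\<^sub>E {..<m} A) = {v. \<forall>i. v $ i \<in> B (inv i)}"
      using m by (subst all) (auto simp: inv B_def PiE_iff)
    also have "emeasure lborel \<dots> = (\<Prod>i\<in>UNIV. emeasure lborel (B (inv i)))"
      using A by (intro emeasure_lborel_coordinate_box) (auto simp: B_def)
    also have "\<dots> = (\<Prod>j<CARD('n). emeasure lborel (B j))"
      by (subst prod.reindex_bij_betw[OF e, symmetric]) (simp add: inv)
    also have "\<dots> = (\<Prod>j<m. emeasure lborel (B j))"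
      using m by (intro prod.mono_neutral_right) (auto simp: B_def)
    also have "\<dots> = (\<Prod>j<m. emeasure lborel (A j))"
      by (simp add: B_def)
    finally show "emeasure \<nu> (Pi\<^sub>E {..<m} A) = (\<Prod>j<m. emeasure lborel (A j))" .
  qed (auto simp: \<nu>_def)
  show ?thesis using \<nu>[OF X, unfolded \<nu>_eq] .
qed

section \<open>Determinants and heights of rows\<close>

text \<open>
  Subtracting from each row its projection onto the span of the earlier rows does not change the
  determinant. The resulting rows are pairwise orthogonal, so the Gram matrix is diagonal and the
  absolute determinant is the product of their lengths. Such a length is the distance of the row from
  that span, hence at most the distance to any chosen \<open>u\<close> in it.
\<close>
lemma abs_det_le_prod_heights:
  fixes A :: "real ^ 'n ^ 'n" and e :: "nat \<Rightarrow> 'n"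
  assumes e: "bij_betw e {..<CARD('n)} UNIV"
    and h: "\<And>i. i < CARD('n) \<Longrightarrow>
      \<exists>u \<in> span ((\<lambda>j. row (e j) A) ` {..<i}). norm (row (e i) A - u) \<le> h i"
  shows "\<bar>det A\<bar> \<le> (\<Prod>i<CARD('n). h i)"
proof -
  define S where "S i = (\<lambda>j. row (e j) A) ` {..<i}" for i
  define inv where "inv = the_inv_into {..<CARD('n)} e"
  have inv: "inv (e i) = i" if "i < CARD('n)" for i
    using that e by (simp add: inv_def bij_betw_def the_inv_into_f_f)
  have inv_less: "inv r < CARD('n)" and e_inv: "e (inv r) = r" for r
    using e the_inv_into_into[of e "{..<CARD('n)}" r "{..<CARD('n)}"]
      f_the_inv_into_f[of e "{..<CARD('n)}" r]
    by (auto simp: inv_def bij_betw_def)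
  have "\<exists>y z. y \<in> span (S i) \<and> (\<forall>w \<in> span (S i). orthogonal z w) \<and> row (e i) A = y + z" for i
    using orthogonal_subspace_decomp_exists[of "S i" "row (e i) A"] by metis
  then obtain y z where y: "\<And>i. y i \<in> span (S i)"
    and z: "\<And>i w. w \<in> span (S i) \<Longrightarrow> orthogonal (z i) w"
    and yz: "\<And>i. row (e i) A = y i + z i"
    by metis
  have z_le: "norm (z i) \<le> h i" if "i < CARD('n)" for i
  proof -
    obtain u where u: "u \<in> span (S i)" "norm (row (e i) A - u) \<le> h i"
      using h[OF \<open>i < CARD('n)\<close>] by (auto simp: S_def)
    have "orthogonal (z i) (y i - u)"
      using u y by (intro z span_diff)
    then have "(norm (z i + (y i - u)))\<^sup>2 = (norm (z i))\<^sup>2 + (norm (y i - u))\<^sup>2"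
      by (rule norm_add_Pythagorean)
    then have "norm (z i) \<le> norm (z i + (y i - u))"
      by (simp add: power2_le_imp_le)
    also have "z i + (y i - u) = row (e i) A - u"
      by (simp add: yz)
    finally show ?thesis using u by simp
  qed
  \<comment> \<open>Rows are replaced from the last to the first, so that the earlier rows, which span the projection
      to be subtracted, are still the original ones.\<close>
  define M where "M k = (\<chi> r. if inv r < k then row r A else z (inv r))" for k
  have row_M: "row r (M k) = (if inv r < k then row r A else z (inv r))" for r k
    by (simp add: M_def row_def vec_eq_iff)
  have step: "det (M k) = det (M (Suc k))" if k: "k < CARD('n)" for k
  proof -
    have "S k \<subseteq> {row j (M (Suc k)) |j. j \<noteq> e k}"
    proof
      fix v assume "v \<in> S k"
      then obtain j where j: "j < k" "v = row (e j) A" by (auto simp: S_def)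
      then have "v = row (e j) (M (Suc k))" "e j \<noteq> e k"
        using k inv[of j] inv[of k] by (auto simp: row_M)
      then show "v \<in> {row j (M (Suc k)) |j. j \<noteq> e k}" by blast
    qed
    then have "- y k \<in> span {row j (M (Suc k)) |j. j \<noteq> e k}"
      using y[of k] span_mono by (blast intro: span_neg)
    then have "det (\<chi> r. if r = e k then row (e k) (M (Suc k)) + - y k else row r (M (Suc k))) = det (M (Suc k))"
      by (intro det_row_span) (simp add: span_vec_eq)
    also have "(\<chi> r. if r = e k then row (e k) (M (Suc k)) + - y k else row r (M (Suc k))) = M k"
    proof -
      have "inv r \<noteq> k" if "r \<noteq> e k" for r
        using that e_inv by metis
      then have "(if r = e k then row (e k) (M (Suc k)) + - y k else row r (M (Suc k))) = M k $ r" for r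
        using inv[OF k] yz[of k] unfolding row_M by (auto simp: M_def less_Suc_eq)
      then show ?thesis
        by (simp add: vec_eq_iff)
    qed
    finally show ?thesis .
  qed
  have "det (M k) = det (M 0)" if "k \<le> CARD('n)" for k
    using that by (induction k) (auto simp: step)
  moreover have "M CARD('n) = A"
    using inv_less by (simp add: M_def row_def vec_eq_iff)
  ultimately have det_A: "det A = det (M 0)" by (metis order_refl)
  have orth: "z i \<bullet> z j = 0" if "i < j" for i j
  proof -
    have "row (e i) A \<in> S j"
      using that by (auto simp: S_def)
    moreover have "y i \<in> span (S j)"
    proof -
      have "S i \<subseteq> S j"
        unfolding S_def using that by (intro image_mono) simp
      then show ?thesis using y[of i] span_mono by blast
    qed
    ultimately have "row (e i) A - y i \<in> span (S j)"
      by (auto intro: span_diff span_base)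
    then have "orthogonal (z j) (z i)"
      using z yz[of i] by simp
    then show ?thesis by (simp add: orthogonal_def inner_commute)
  qed
  have row_M0: "row r (M 0) = z (inv r)" for r
    by (simp add: row_M)
  have gram: "(M 0 ** transpose (M 0)) $ r $ s = z (inv r) \<bullet> z (inv s)" for r s
    unfolding row_M0[symmetric] by (simp add: matrix_matrix_mult_def transpose_def row_def inner_vec_def)
  have "(det (M 0))\<^sup>2 = det (M 0 ** transpose (M 0))"
    by (simp add: det_mul power2_eq_square)
  also have "\<dots> = (\<Prod>r\<in>UNIV. (M 0 ** transpose (M 0)) $ r $ r)"
  proof (rule det_diagonal)
    fix r s :: 'n assume "r \<noteq> s"
    then have "inv r \<noteq> inv s" using e_inv by metis
    then show "(M 0 ** transpose (M 0)) $ r $ s = 0"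
      using orth[of "inv r" "inv s"] orth[of "inv s" "inv r"] by (auto simp: gram inner_commute neq_iff)
  qed
  also have "\<dots> = (\<Prod>r\<in>UNIV. norm (z (inv r)))\<^sup>2"
    by (simp add: gram power2_norm_eq_inner prod_power_distrib)
  finally have "\<bar>det A\<bar>\<^sup>2 = (\<Prod>r\<in>UNIV. norm (z (inv r)))\<^sup>2"
    unfolding det_A by simp
  then have "\<bar>det A\<bar> = (\<Prod>r\<in>UNIV. norm (z (inv r)))"
    by (rule power2_eq_imp_eq) (auto intro: prod_nonneg)
  also have "\<dots> = (\<Prod>i<CARD('n). norm (z i))"
    by (subst prod.reindex_bij_betw[OF e, symmetric]) (simp add: inv)
  also have "\<dots> \<le> (\<Prod>i<CARD('n). h i)"
    by (intro prod_mono) (auto simp: z_le)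
  finally show ?thesis .
qed

section \<open>The volume of a simplex and its heights\<close>

text \<open>
  The coefficients of a point of the simplex also have sum at most \<open>1\<close>. Ignoring this loses only
  the factor \<open>m!\<close> between the volumes of parallelepiped and simplex.
\<close>
lemma convex_hull_subset_parallelepiped:
  fixes x :: "nat \<Rightarrow> 'a::real_vector"
  assumes "w \<in> convex hull (x ` {..m})"
  shows "\<exists>t. (\<forall>i<m. t i \<in> {0..1::real}) \<and> w = x 0 + (\<Sum>i<m. t i *\<^sub>R (x (Suc i) - x 0))"
proof -
  define Q where "Q = (\<lambda>t. x 0 + (\<Sum>i<m. t i *\<^sub>R (x (Suc i) - x 0))) ` {t. \<forall>i<m. t i \<in> {0..1::real}}"
  have "convex Q"
    unfolding convex_alt
  proof (intro ballI allI impI)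
    fix y z u assume "y \<in> Q" "z \<in> Q" and u: "0 \<le> u \<and> u \<le> (1::real)"
    then obtain s t where s: "\<And>i. i < m \<Longrightarrow> s i \<in> {0..1::real}" "y = x 0 + (\<Sum>i<m. s i *\<^sub>R (x (Suc i) - x 0))"
      and t: "\<And>i. i < m \<Longrightarrow> t i \<in> {0..1::real}" "z = x 0 + (\<Sum>i<m. t i *\<^sub>R (x (Suc i) - x 0))"
      by (auto simp: Q_def)
    have "(1 - u) *\<^sub>R y + u *\<^sub>R z = x 0 + (\<Sum>i<m. ((1 - u) * s i + u * t i) *\<^sub>R (x (Suc i) - x 0))"
      unfolding s t by (simp add: algebra_simps sum.distrib scaleR_sum_right sum_subtractf)
    moreover have "(1 - u) * s i + u * t i \<in> {0..1}" if "i < m" for i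
      using s(1)[OF that] t(1)[OF that] u convex_bound_le[of "s i" 1 "t i" "1 - u" u] by auto
    ultimately show "(1 - u) *\<^sub>R y + u *\<^sub>R z \<in> Q"
      unfolding Q_def by (intro image_eqI[where x = "\<lambda>i. (1 - u) * s i + u * t i"]) auto
  qed
  moreover have "x i \<in> Q" if "i \<le> m" for i
  proof (cases i)
    case 0
    have "x 0 = x 0 + (\<Sum>i<m. 0 *\<^sub>R (x (Suc i) - x 0))" by simp
    then show ?thesis unfolding Q_def 0 by (intro image_eqI[where x = "\<lambda>_. 0"]) auto
  next
    case (Suc l)
    with that have "(\<Sum>i<m. (if i = l then 1 else 0) *\<^sub>R (x (Suc i) - x 0)) = x (Suc l) - x 0"
      by (subst sum.remove[of _ l]) auto
    then show ?thesis
      unfolding Q_def Suc by (intro image_eqI[where x = "\<lambda>i. if i = l then 1 else 0"]) auto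
  qed
  ultimately have "convex hull (x ` {..m}) \<subseteq> Q"
    by (intro hull_minimal) auto
  with assms show ?thesis by (auto simp: Q_def)
qed

lemma bessel_orthonormal_frame:
  assumes "orthonormal_frame m b"
  shows "(\<Sum>i<m. (w \<bullet> b i)\<^sup>2) \<le> (norm w)\<^sup>2"
proof -
  define u where "u = (\<Sum>i<m. (w \<bullet> b i) *\<^sub>R b i)"
  have wu: "w \<bullet> u = (\<Sum>i<m. (w \<bullet> b i)\<^sup>2)"
    by (simp add: u_def inner_sum_right power2_eq_square)
  have "u \<bullet> b j = w \<bullet> b j" if "j < m" for j
  proof -
    have "u \<bullet> b j = (\<Sum>i<m. if i = j then w \<bullet> b i else 0)"
      using assms that unfolding u_def inner_sum_left orthonormal_frame_def
      by (intro sum.cong) auto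
    with that show ?thesis by simp
  qed
  then have "u \<bullet> u = (\<Sum>i<m. (w \<bullet> b i)\<^sup>2)"
    unfolding u_def inner_sum_right[of _ _ "{..<m}"]
    by (simp add: power2_eq_square u_def[symmetric])
  with wu have "(norm w)\<^sup>2 - (\<Sum>i<m. (w \<bullet> b i)\<^sup>2) = (norm (w - u))\<^sup>2"
    by (simp add: power2_norm_eq_inner inner_diff_left inner_diff_right inner_commute)
  then show ?thesis
    by (metis diff_ge_0_iff_ge zero_le_power2)
qed

text \<open>
  The heights are those of the edges in the ambient space, while the measure is taken in the
  coordinates of an arbitrary frame. Passing to coordinates is a contraction by Bessel's inequality,
  so it does not increase heights, whatever the frame. The type \<open>'n\<close> indexes a coordinate space with
  room for \<open>m\<close> coordinates; its well-order makes the change of variables formula applicable.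
\<close>
lemma measure_simplex_coordinates_le:
  fixes b x :: "nat \<Rightarrow> 'a::euclidean_space"
  assumes m: "m \<le> CARD('n::{finite,wellorder})" and b: "orthonormal_frame m b"
    and h: "\<And>i. i < m \<Longrightarrow>
      \<exists>u \<in> span ((\<lambda>l. x (Suc l) - x 0) ` {..<i}). norm (x (Suc i) - x 0 - u) \<le> h i"
  shows "measure (Pi\<^sub>M {..<m} (\<lambda>_. lborel))
      {y \<in> {..<m} \<rightarrow>\<^sub>E UNIV. frame_point m p b y \<in> convex hull (x ` {..m})} \<le> (\<Prod>i<m. h i)"
    (is "measure ?M ?X \<le> _")
proof (cases "?X \<in> sets ?M")
  case False
  have "0 \<le> h i" if "i < m" for i
    using h[OF that] by (meson norm_ge_zero order_trans)
  with False show ?thesis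
    by (auto simp: measure_notin_sets intro!: prod_nonneg)
next
  case True
  obtain e :: "nat \<Rightarrow> 'n" where e: "bij_betw e {..<CARD('n)} UNIV"
    using ex_bij_betw_nat_finite[of "UNIV :: 'n set"] by (auto simp: atLeast0LessThan)
  define inv where "inv = the_inv_into {..<CARD('n)} e"
  have inv: "inv (e i) = i" if "i < CARD('n)" for i
    using that e by (simp add: inv_def bij_betw_def the_inv_into_f_f)
  have inv_less: "inv r < CARD('n)" and e_inv: "e (inv r) = r" for r
    using e the_inv_into_into[of e "{..<CARD('n)}" r "{..<CARD('n)}"]
      f_the_inv_into_f[of e "{..<CARD('n)}" r]
    by (auto simp: inv_def bij_betw_def)
  have sum_UNIV: "(\<Sum>r\<in>UNIV. f (inv r)) = (\<Sum>i<CARD('n). f i)" for f :: "nat \<Rightarrow> real"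
    by (subst sum.reindex_bij_betw[OF e, symmetric]) (simp add: inv)
  define v where "v i = x (Suc i) - x 0" for i
  define c where "c w = (\<chi> r :: 'n::{finite,wellorder}. if inv r < m then w \<bullet> b (inv r) else 0)" for w :: 'a
  have c: "linear c"
    by (rule linearI) (auto simp: c_def vec_eq_iff inner_add_left)
  have c_le: "norm (c w) \<le> norm w" for w
  proof -
    have "(norm (c w))\<^sup>2 = (\<Sum>r\<in>UNIV. (if inv r < m then (w \<bullet> b (inv r))\<^sup>2 else 0))"
      unfolding power2_norm_eq_inner inner_vec_def c_def
      by (intro sum.cong) (auto simp: power2_eq_square)
    also have "\<dots> = (\<Sum>i<CARD('n). if i < m then (w \<bullet> b i)\<^sup>2 else 0)"
      by (rule sum_UNIV)
    also have "\<dots> = (\<Sum>i<m. (w \<bullet> b i)\<^sup>2)"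
      using m by (intro sum.mono_neutral_cong_right) auto
    also have "\<dots> \<le> (norm w)\<^sup>2"
      by (rule bessel_orthonormal_frame[OF b])
    finally show ?thesis by (rule power2_le_imp_le) simp
  qed
  \<comment> \<open>The first \<open>m\<close> rows are the edges in coordinates; the others are unit vectors, of height at most \<open>1\<close>,
      which span the unit intervals of the cylinder.\<close>
  define A where "A = (\<chi> r. if inv r < m then c (v (inv r)) else axis r 1)"
  have row_A: "row r A = (if inv r < m then c (v (inv r)) else axis r 1)" for r
    by (simp add: A_def row_def vec_eq_iff)
  have "\<bar>det A\<bar> \<le> (\<Prod>i<CARD('n). if i < m then h i else 1)"
  proof (rule abs_det_le_prod_heights[OF e])
    fix i assume i: "i < CARD('n)"
    show "\<exists>u\<in>span ((\<lambda>j. row (e j) A) ` {..<i}). norm (row (e i) A - u) \<le> (if i < m then h i else 1)"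
    proof (cases "i < m")
      case True
      then obtain u where u: "u \<in> span (v ` {..<i})" "norm (v i - u) \<le> h i"
        using h[of i] by (auto simp: v_def)
      have "(\<lambda>j. row (e j) A) ` {..<i} = c ` v ` {..<i}"
        unfolding image_image using True i by (intro image_cong) (auto simp: row_A inv)
      then have "c u \<in> span ((\<lambda>j. row (e j) A) ` {..<i})"
        using u by (simp add: linear_span_image[OF c])
      moreover have "norm (row (e i) A - c u) \<le> h i"
        using c_le[of "v i - u"] u True i by (simp add: row_A inv linear_diff[OF c])
      ultimately show ?thesis using True by auto
    next
      case False
      then show ?thesis
        by (intro bexI[of _ 0]) (simp_all add: row_A inv i span_zero)
    qed
  qed
  also have "\<dots> = (\<Prod>i<m. h i)"
    using m by (intro prod.mono_neutral_cong_right) auto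
  finally have det_le: "\<bar>det A\<bar> \<le> (\<Prod>i<m. h i)" .
  define L where "L = (*v) (transpose A)"
  have L: "linear L" "matrix L = transpose A"
    unfolding L_def by (rule matrix_vector_mul_linear, rule matrix_of_matrix_vector_mul)
  define K where "K = (+) (c (x 0 - p)) ` L ` cbox 0 1"
  have "compact K"
    unfolding K_def
    by (intro compact_translation compact_continuous_image linear_continuous_on compact_cbox)
       (use L in \<open>simp add: linear_conv_bounded_linear\<close>)
  then have K: "K \<in> sets borel" "emeasure lborel K < \<infinity>"
    using emeasure_compact_finite[of K] by (auto intro: borel_compact)
  have "measure lborel K = measure lebesgue K"
    using K by simp
  also have "\<dots> = measure lebesgue (L ` cbox 0 1)"
    unfolding K_def by (rule measure_translation)
  also have "\<dots> = \<bar>det (matrix L)\<bar> * measure lebesgue (cbox 0 (1 :: real ^ 'n::{finite,wellorder}))"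
    by (intro measure_linear_image L) auto
  also have "measure lebesgue (cbox 0 (1 :: real ^ 'n::{finite,wellorder})) = 1"
    by (simp add: content_cbox_if_cart interval_ne_empty_cart)
  finally have K_measure: "measure lborel K = \<bar>det A\<bar>"
    by (simp add: L)
  let ?cyl = "{w :: real ^ 'n::{finite,wellorder}. (\<lambda>i\<in>{..<m}. w $ e i) \<in> ?X \<and> (\<forall>i\<in>{m..<CARD('n)}. w $ e i \<in> {0..1})}"
  \<comment> \<open>On the cylinder, the coefficients are those of the simplex point for the edges, and the surplus
      coordinates themselves for the unit vectors.\<close>
  have "?cyl \<subseteq> K"
  proof
    fix w assume w: "w \<in> ?cyl"
    let ?y = "\<lambda>i\<in>{..<m}. w $ e i"
    have "frame_point m p b ?y \<in> convex hull (x ` {..m})"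
      using w by auto
    then obtain t where t: "\<And>i. i < m \<Longrightarrow> t i \<in> {0..1}"
      and y: "frame_point m p b ?y = x 0 + (\<Sum>i<m. t i *\<^sub>R v i)"
      unfolding v_def using convex_hull_subset_parallelepiped by blast
    define \<tau> where "\<tau> = (\<chi> r. if inv r < m then t (inv r) else w $ r)"
    have "w $ r \<in> {0..1}" if "\<not> inv r < m" for r
    proof -
      have "inv r \<in> {m..<CARD('n)}" using that inv_less[of r] by simp
      then have "w $ e (inv r) \<in> {0..1}" using w by blast
      then show ?thesis by (simp add: e_inv)
    qed
    then have "\<tau> \<in> cbox 0 1"
      using t by (auto simp: mem_box_cart \<tau>_def)
    moreover have "w = c (x 0 - p) + L \<tau>"
    proof -
      have yb: "(\<Sum>i<m. w $ e i *\<^sub>R b i) = (x 0 - p) + (\<Sum>i<m. t i *\<^sub>R v i)"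
        using y by (simp add: frame_point_def algebra_simps)
      have "w $ r = c (x 0 - p) $ r + L \<tau> $ r" for r
      proof (cases "inv r < m")
        case True
        have "w $ r = (\<Sum>i<m. w $ e i *\<^sub>R b i) \<bullet> b (inv r)"
        proof -
          have "(\<Sum>i<m. w $ e i *\<^sub>R b i) \<bullet> b (inv r) = (\<Sum>i<m. if i = inv r then w $ e i else 0)"
            using b True unfolding inner_sum_left orthonormal_frame_def
            by (intro sum.cong) auto
          with True show ?thesis by (simp add: e_inv)
        qed
        also have "\<dots> = (x 0 - p) \<bullet> b (inv r) + (\<Sum>i<m. t i * (v i \<bullet> b (inv r)))"
          unfolding yb by (simp add: inner_add_left inner_sum_left)
        also have "(\<Sum>i<m. t i * (v i \<bullet> b (inv r))) = (\<Sum>i<CARD('n). if i < m then t i * (v i \<bullet> b (inv r)) else 0)"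
          using m by (intro sum.mono_neutral_cong_left) auto
        also have "\<dots> = (\<Sum>s\<in>UNIV. if inv s < m then t (inv s) * (v (inv s) \<bullet> b (inv r)) else 0)"
          by (rule sum_UNIV[symmetric])
        also have "\<dots> = L \<tau> $ r"
          using True unfolding L_def matrix_vector_mult_def
          by (auto simp: transpose_def A_def \<tau>_def c_def axis_def intro!: sum.cong)
        finally show ?thesis using True by (simp add: c_def)
      next
        case False
        have "L \<tau> $ r = (\<Sum>s\<in>UNIV. A $ s $ r * \<tau> $ s)"
          by (simp add: L_def matrix_vector_mult_def transpose_def)
        also have "\<dots> = (\<Sum>s\<in>UNIV. if s = r then w $ s else 0)"
          using False by (intro sum.cong) (auto simp: A_def \<tau>_def c_def axis_def)
        finally show ?thesis using False by (simp add: c_def)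
      qed
      then show ?thesis by (simp add: vec_eq_iff)
    qed
    ultimately show "w \<in> K" by (auto simp: K_def)
  qed
  then have "emeasure ?M ?X \<le> emeasure lborel K"
    using K by (subst emeasure_PiM_lborel_eq_cylinder[OF e m True]) (intro emeasure_mono, auto)
  then have "measure ?M ?X \<le> measure lborel K"
    using K unfolding measure_def by (intro enn2real_mono) auto
  with K_measure det_le show ?thesis by simp
qed

text \<open>
  Guarantees that the choice in the definition of \<open>flat_volume\<close> returns a frame. For a degenerate simplex the
  edges span fewer than \<open>m\<close> dimensions, so a basis of their span is first enlarged to \<open>m\<close> vectors.
\<close>
lemma ex_frame_containing:
  fixes x :: "nat \<Rightarrow> 'a::euclidean_space"
  assumes m: "m \<le> DIM('a)"
  shows "\<exists>p b. orthonormal_frame m b \<and> convex hull (x ` {..m}) \<subseteq> range (frame_point m p b)"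
proof -
  define V where "V = (\<lambda>i. x (Suc i) - x 0) ` {..<m}"
  obtain I where I: "I \<subseteq> V" "independent I" "V \<subseteq> span I"
    by (rule maximal_independent_subset)
  obtain J where J: "I \<subseteq> J" "independent J" "UNIV \<subseteq> span J"
    using maximal_independent_subset_extend[of I UNIV] I by auto
  have "card I \<le> card V"
    using I by (intro card_mono) (auto simp: V_def)
  also have "\<dots> \<le> m"
    unfolding V_def using card_image_le[of "{..<m}"] by auto
  finally have "card I \<le> m" .
  moreover have "card J = DIM('a)"
    using J by (metis basis_card_eq_dim dim_UNIV subset_UNIV)
  moreover have "finite J" 
    using J by (simp add: finiteI_independent)
  ultimately obtain T where T: "I \<subseteq> T" "T \<subseteq> J" "card T = m"
    using exists_subset_between[of I m J] J m by auto
  then have "independent T" using J independent_mono by blast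
  then have "dim (span T) = m" using T by (simp add: dim_eq_card_independent)
  then obtain B where B: "pairwise orthogonal B" "\<And>x. x \<in> B \<Longrightarrow> norm x = 1"
    "independent B" "card B = m" "span B = span T"
    using orthonormal_basis_subspace[of "span T"] by (metis subspace_span)
  have "finite B" using B by (simp add: finiteI_independent)
  then obtain b where b: "bij_betw b {..<m} B"
    using ex_bij_betw_nat_finite[of B] B by (auto simp: atLeast0LessThan)
  have "orthonormal_frame m b"
    unfolding orthonormal_frame_def
  proof (intro allI impI)
    fix i j assume ij: "i < m" "j < m"
    then have bij: "b i \<in> B" "b j \<in> B" "b i = b j \<longleftrightarrow> i = j"
      using b by (auto simp: bij_betw_def inj_on_def)
    then show "b i \<bullet> b j = (if i = j then 1 else 0)"
      using B(1,2) by (auto simp: pairwise_def orthogonal_def dot_square_norm)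
  qed
  moreover have "convex hull (x ` {..m}) \<subseteq> range (frame_point m (x 0) b)"
  proof
    fix w assume "w \<in> convex hull (x ` {..m})"
    then obtain t where "w = x 0 + (\<Sum>i<m. t i *\<^sub>R (x (Suc i) - x 0))"
      using convex_hull_subset_parallelepiped by blast
    moreover have "(\<Sum>i<m. t i *\<^sub>R (x (Suc i) - x 0)) \<in> span V"
      by (intro span_sum span_scale span_base) (auto simp: V_def)
    moreover have "span V \<subseteq> span B"
      unfolding B using I T by (metis span_mono span_span order_trans)
    ultimately have "w - x 0 \<in> span B" by auto
    then obtain u where "w - x 0 = (\<Sum>v\<in>B. u v *\<^sub>R v)"
      using span_finite[OF \<open>finite B\<close>] by auto
    also have "\<dots> = (\<Sum>i<m. u (b i) *\<^sub>R b i)"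
      by (rule sum.reindex_bij_betw[OF b, symmetric])
    finally have "w = frame_point m (x 0) b (\<lambda>i. u (b i))"
      by (simp add: frame_point_def algebra_simps)
    then show "w \<in> range (frame_point m (x 0) b)" by blast
  qed
  ultimately show ?thesis by blast
qed

lemma flat_volume_simplex_le_prod_heights:
  fixes x :: "nat \<Rightarrow> real ^ 'n"
  assumes m: "m \<le> CARD('n)"
    and h: "\<And>i. i < m \<Longrightarrow>
      \<exists>u \<in> span ((\<lambda>l. x (Suc l) - x 0) ` {..<i}). norm (x (Suc i) - x 0 - u) \<le> h i"
  shows "flat_volume m (convex hull (x ` {..m})) \<le> (\<Prod>i<m. h i)"
proof -
  let ?P = "\<lambda>(p, b). orthonormal_frame m b \<and> convex hull (x ` {..m}) \<subseteq> range (frame_point m p b)"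
  obtain p b where pb: "(SOME pb. ?P pb) = (p, b)" by force
  have "\<exists>pb. ?P pb"
    using ex_frame_containing[of m x] m by auto
  then have "?P (SOME pb. ?P pb)" by (rule someI_ex)
  then have "orthonormal_frame m b" unfolding pb by simp
  then show ?thesis
    unfolding flat_volume_def pb Let_def prod.case
    \<comment> \<open>\<open>'n bit0\<close> is a well-ordered index type with more than \<open>m\<close> elements.\<close>
    using m by (intro measure_simplex_coordinates_le[where 'n = "'n bit0"] h) simp_all
qed

section \<open>Points that are close modulo a subspace\<close>

lemma pigeonhole_fibre:
  assumes "finite P" "finite C" "C \<noteq> {}" "f ` P \<subseteq> C" "s * card C \<le> card P"
  shows "\<exists>Q \<subseteq> P. card Q = s \<and> (\<forall>x\<in>Q. \<forall>y\<in>Q. f x = f y)"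
proof -
  have "\<exists>c\<in>C. s \<le> card {x \<in> P. f x = c}"
  proof (rule ccontr)
    assume "\<not> ?thesis"
    then have "(\<Sum>c\<in>C. card {x \<in> P. f x = c}) < (\<Sum>c\<in>C. s)"
      using assms by (intro sum_strict_mono) auto
    moreover have "(\<Sum>c\<in>C. card {x \<in> P. f x = c}) = card P"
      using sum.group[of P C f "\<lambda>_. 1 :: nat"] assms by simp
    ultimately show False
      using assms by (simp add: mult.commute)
  qed
  then obtain c where "s \<le> card {x \<in> P. f x = c}" by blast
  then obtain Q where "Q \<subseteq> {x \<in> P. f x = c}" "card Q = s"
    by (meson obtain_subset_with_card_n)
  then show ?thesis by (intro exI[of _ Q]) auto
qed

text \<open>
  Cut the projection of the ball of radius \<open>R\<close> to the orthogonal complement of \<open>U\<close>, of dimension \<open>d'\<close>,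
  into \<open>M ^ d'\<close> boxes with \<open>M\<close> about \<open>(card P / s) powr (1 / d')\<close>. On average a box contains at least \<open>s\<close>
  of the points, and points of one box are close modulo \<open>U\<close>.
\<close>
lemma close_points_modulo_subspace:
  fixes U P :: "'a::euclidean_space set"
  assumes U: "subspace U" and d': "d' = DIM('a) - dim U" "d' > 0"
    and P: "finite P" "\<And>x. x \<in> P \<Longrightarrow> norm x < R" and s: "1 \<le> s" "s \<le> card P"
  shows "\<exists>Q \<subseteq> P. card Q = s \<and> (\<forall>x\<in>Q. \<forall>y\<in>Q. \<exists>u\<in>U.
    norm (x - y - u) \<le> 4 * R * d' * (s / card P) powr (1 / d'))"
proof -
  have "card P > 0" using s by simp
  then have "P \<noteq> {}" by auto
  then have R: "R > 0" using P norm_ge_zero by (metis all_not_in_conv le_less_trans)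
  define y where "y = (card P / s) powr (1 / d')"
  have y1: "1 \<le> y"
    unfolding y_def using s by (intro ge_one_powr_ge_zero) (auto simp: field_simps)
  have y_power: "y ^ d' = card P / s"
    using d' s \<open>card P > 0\<close> unfolding y_def by (simp add: powr_powr flip: powr_realpow)
  \<comment> \<open>As \<open>y \<ge> 1\<close>, rounding down loses at most a factor \<open>2\<close>.\<close>
  define M where "M = nat \<lfloor>y\<rfloor>"
  have M: "1 \<le> M" "real M \<le> y" "y \<le> 2 * real M"
  proof -
    have "1 \<le> \<lfloor>y\<rfloor>" using y1 by simp
    moreover from this have "real M = of_int \<lfloor>y\<rfloor>" by (simp add: M_def)
    ultimately show "1 \<le> M" "real M \<le> y" "y \<le> 2 * real M"
      by linarith+
  qed
  have "real M ^ d' \<le> card P / s"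
    unfolding y_power[symmetric] using M by (intro power_mono) auto
  then have "real (s * M ^ d') \<le> real (card P)"
    using s by (simp add: field_simps)
  then have sM: "s * M ^ d' \<le> card P" by linarith
  define V where "V = {y \<in> UNIV. \<forall>x \<in> U. orthogonal x y}"
  have "dim V + dim U = dim (UNIV :: 'a set)"
    unfolding V_def using U by (intro dim_subspace_orthogonal_to_vectors) auto
  then have dim_V: "dim V = d'" using d' by simp
  have "subspace V"
    unfolding V_def using subspace_orthogonal_to_vectors[of U] by simp
  then obtain B where B: "B \<subseteq> V" "pairwise orthogonal B" "\<And>x. x \<in> B \<Longrightarrow> norm x = 1"
    "independent B" "card B = d'" "span B = V"
    using orthonormal_basis_subspace[of V] unfolding dim_V by metis
  have "finite B" using B by (simp add: finiteI_independent)
  define g where "g x c = M * (x \<bullet> c + R) / (2 * R)" for x c :: 'a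
  define f where "f x = (\<lambda>c\<in>B. nat \<lfloor>g x c\<rfloor>)" for x
  have g_bounds: "0 \<le> g x c" "g x c < M" if "x \<in> P" "c \<in> B" for x c
  proof -
    have "\<bar>x \<bullet> c\<bar> < R"
      using Cauchy_Schwarz_ineq2[of x c] B(3)[OF that(2)] P(2)[OF that(1)] by simp
    then have "0 \<le> x \<bullet> c + R" "x \<bullet> c + R < 2 * R" by linarith+
    then show "0 \<le> g x c" "g x c < M"
      using R M(1) by (auto simp: g_def divide_simps)
  qed
  have "f ` P \<subseteq> Pi\<^sub>E B (\<lambda>_. {..<M})"
  proof
    fix w assume "w \<in> f ` P"
    then obtain x where "x \<in> P" "w = f x" by blast
    moreover have "nat \<lfloor>g x c\<rfloor> < M" if "c \<in> B" for c
      using g_bounds[OF \<open>x \<in> P\<close> that] by linarith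
    ultimately show "w \<in> Pi\<^sub>E B (\<lambda>_. {..<M})" by (auto simp: f_def)
  qed
  moreover have "Pi\<^sub>E B (\<lambda>_. {..<M}) \<noteq> {}"
    using M by (auto simp: PiE_eq_empty_iff lessThan_empty_iff)
  moreover have "s * card (Pi\<^sub>E B (\<lambda>_. {..<M})) \<le> card P"
    using sM B by (simp add: card_PiE \<open>finite B\<close>)
  ultimately obtain Q where Q: "Q \<subseteq> P" "card Q = s" "\<And>x y. x \<in> Q \<Longrightarrow> y \<in> Q \<Longrightarrow> f x = f y"
    using pigeonhole_fibre[of P "Pi\<^sub>E B (\<lambda>_. {..<M})" f s] P(1) \<open>finite B\<close>
    by (auto intro: finite_PiE)
  have "\<exists>u\<in>U. norm (x - z - u) \<le> 4 * R * d' * (s / card P) powr (1 / d')"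
    if xz: "x \<in> Q" "z \<in> Q" for x z
  proof -
    have close: "\<bar>(x - z) \<bullet> c\<bar> \<le> 2 * R / M" if c: "c \<in> B" for c
    proof -
      have "nat \<lfloor>g x c\<rfloor> = nat \<lfloor>g z c\<rfloor>"
        using Q(3)[OF xz] c by (auto simp: f_def fun_eq_iff split: if_splits)
      moreover have "0 \<le> g x c" "0 \<le> g z c"
        using g_bounds(1) xz Q(1) c by blast+
      ultimately have "\<lfloor>g x c\<rfloor> = \<lfloor>g z c\<rfloor>"
        by (simp add: eq_nat_nat_iff)
      then have "\<bar>g x c - g z c\<bar> \<le> 1"
        by linarith
      moreover have "g x c - g z c = M * ((x - z) \<bullet> c) / (2 * R)"
        using R by (simp add: g_def field_simps inner_diff_left)
      ultimately have "\<bar>M * ((x - z) \<bullet> c) / (2 * R)\<bar> \<le> 1" by simp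
      then have "M * \<bar>(x - z) \<bullet> c\<bar> \<le> 2 * R"
        using R by (simp add: abs_mult field_simps)
      then show ?thesis using M by (simp add: field_simps)
    qed
    obtain u w where u: "u \<in> span U" and w: "\<And>v. v \<in> span U \<Longrightarrow> orthogonal w v"
      and uw: "x - z = u + w"
      using orthogonal_subspace_decomp_exists[of U "x - z"] by metis
    have "w \<in> V"
      using w by (auto simp: V_def orthogonal_commute span_base)
    then have "w = (\<Sum>c\<in>B. (w \<bullet> c) *\<^sub>R c)"
      using B \<open>finite B\<close> by (intro orthonormal_basis_expand[symmetric]) auto
    then have "norm w \<le> (\<Sum>c\<in>B. norm ((w \<bullet> c) *\<^sub>R c))"
      by (metis norm_sum)
    also have "\<dots> \<le> (\<Sum>c\<in>B. 2 * R / M)"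
    proof (rule sum_mono)
      fix c assume c: "c \<in> B"
      then have "u \<bullet> c = 0"
        using B(1) u U by (auto simp: V_def orthogonal_def span_eq_iff[THEN iffD2])
      then have "w \<bullet> c = (x - z) \<bullet> c"
        by (simp add: uw inner_add_left)
      then show "norm ((w \<bullet> c) *\<^sub>R c) \<le> 2 * R / M"
        using close[OF c] B(3)[OF c] by simp
    qed
    also have "\<dots> = 4 * R * d' * (1 / (2 * M))"
      using B by simp
    also have "\<dots> \<le> 4 * R * d' * (1 / y)"
      using M y1 R by (intro mult_left_mono divide_left_mono) auto
    also have "1 / y = (s / card P) powr (1 / d')"
      unfolding y_def using s by (simp add: powr_divide)
    finally show ?thesis
      using u U uw by (intro bexI[of _ u]) (auto simp: span_eq_iff[THEN iffD2])
  qed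
  with Q show ?thesis by blast
qed

section \<open>Chains of vertices built from blocks\<close>

text \<open>
  The edge \<open>x 0 - x 0\<close> vanishes, so \<open>h 0\<close> is not a height. Keeping it in the product, with value at
  least \<open>1\<close>, lets the initial block be treated like all others.
\<close>
definition height_chain :: "'a::euclidean_space set \<Rightarrow> nat \<Rightarrow> (nat \<Rightarrow> 'a) \<Rightarrow> (nat \<Rightarrow> real) \<Rightarrow> bool" where
  "height_chain P j x h \<longleftrightarrow> inj_on x {..<j} \<and> x ` {..<j} \<subseteq> P \<and> (0 < j \<longrightarrow> 1 \<le> h 0) \<and>
    (\<forall>i<j. \<exists>u \<in> span ((\<lambda>l. x l - x 0) ` {..<i}). norm (x i - x 0 - u) \<le> h i)"

lemma dim_edge_span:
  fixes x :: "nat \<Rightarrow> 'a::euclidean_space"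
  assumes "inj_on x {..<j}" "\<not> affine_dependent (x ` {..<j})"
  shows "dim (span ((\<lambda>l. x l - x 0) ` {..<j})) = j - 1"
proof (cases j)
  case (Suc j')
  have lessThan_j: "{..<j} = insert 0 {1..<j}" using Suc by auto
  have "x ` {1..<j} = x ` {..<j} - {x 0}"
    using assms(1) unfolding lessThan_j by (subst (asm) inj_on_insert) auto
  moreover have "x 0 \<in> x ` {..<j}" using Suc by auto
  moreover define T where "T = (\<lambda>y. - x 0 + y) ` (x ` {1..<j})"
  ultimately have "independent T"
    using assms(2) affine_dependent_iff_dependent2[of "x 0" "x ` {..<j}"] by simp
  moreover have "card T = j - 1"
  proof -
    have "inj_on x {1..<j}" using assms(1) by (rule inj_on_subset) auto
    then have "card (x ` {1..<j}) = j - 1" by (simp add: card_image)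
    then show ?thesis unfolding T_def by (subst card_image) simp_all
  qed
  moreover have "(\<lambda>l. x l - x 0) ` {..<j} = insert 0 T"
    unfolding lessThan_j T_def image_insert image_image by simp
  ultimately show ?thesis
    by (simp add: dim_eq_card_independent)
qed auto

text \<open>
  Adds one block. For \<open>j = 0\<close> the truncated difference \<open>j - 1\<close> is \<open>0\<close>, the correct dimension
  of the span of no edges, so the initial block needs no separate argument.
\<close>
lemma height_chain_extend:
  fixes P :: "'a::euclidean_space set"
  assumes P: "finite P" "\<And>x. x \<in> P \<Longrightarrow> norm x < R" and R: "1 \<le> R"
    and indep: "\<And>T. T \<subseteq> P \<Longrightarrow> card T \<le> k \<Longrightarrow> \<not> affine_dependent T"
    and k: "k \<le> card P" "k \<le> DIM('a) + 1"
    and s: "1 \<le> s" "j + s \<le> k"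
    and chain: "height_chain P j x h"
    and d': "d' = DIM('a) - (j - 1)"
    and \<delta>: "\<delta> = 4 * R * d' * (s / real (card P - j)) powr (1 / d')"
  obtains x' h' where "height_chain P (j + s) x' h'"
    and "(\<Prod>i<j+s. h' i) = (\<Prod>i<j. h i) * (2 * R * \<delta> ^ (s - 1))"
proof -
  define U where "U = span ((\<lambda>l. x l - x 0) ` {..<j})"
  have inj: "inj_on x {..<j}" and x: "x ` {..<j} \<subseteq> P"
    using chain by (auto simp: height_chain_def)
  have card_x: "card (x ` {..<j}) = j"
    using inj by (simp add: card_image)
  have dim_U: "dim U = j - 1"
    unfolding U_def using inj x card_x s by (intro dim_edge_span indep) auto
  have card_P': "card (P - x ` {..<j}) = card P - j"
    using P x card_x by (simp add: card_Diff_subset finite_subset)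
  have "\<exists>Q \<subseteq> P - x ` {..<j}. card Q = s \<and> (\<forall>y\<in>Q. \<forall>z\<in>Q. \<exists>u\<in>U. norm (y - z - u) \<le> \<delta>)"
    unfolding \<delta> card_P'[symmetric]
  proof (rule close_points_modulo_subspace)
    show "subspace U" unfolding U_def by simp
    show "d' = DIM('a) - dim U" unfolding dim_U by (fact d')
    show "d' > 0" using s k DIM_positive[where 'a='a] unfolding d' by linarith
    show "s \<le> card (P - x ` {..<j})" unfolding card_P' using s k by linarith
  qed (use P s in auto)
  then obtain Q where Q: "Q \<subseteq> P - x ` {..<j}" "card Q = s"
    "\<And>y z. y \<in> Q \<Longrightarrow> z \<in> Q \<Longrightarrow> \<exists>u\<in>U. norm (y - z - u) \<le> \<delta>"
    by blast
  have "finite Q" using Q(1) P(1) by (meson finite_Diff finite_subset)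
  then obtain q where q: "bij_betw q {..<s} Q"
    using ex_bij_betw_nat_finite[of Q] Q by (auto simp: atLeast0LessThan)
  have q_mem: "q i \<in> Q" if "i < s" for i
    using q that by (auto simp: bij_betw_def)
  define x' where "x' i = (if i < j then x i else q (i - j))" for i
  define h' where "h' i = (if i < j then h i else if i = j then 2 * R else \<delta>)" for i
  have x'_P: "x' i \<in> P" if "i < j + s" for i
  proof (cases "i < j")
    case True
    then show ?thesis using x by (auto simp: x'_def)
  next
    case False
    then have "q (i - j) \<in> Q" using that by (intro q_mem) linarith
    then show ?thesis using False Q(1) by (auto simp: x'_def)
  qed
  have "inj_on x' {..<j + s}"
  proof (rule inj_onI)
    fix a b assume ab: "a \<in> {..<j + s}" "b \<in> {..<j + s}" "x' a = x' b"
    have neq: "x a \<noteq> q b" if "a < j" "b < s" for a b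
    proof -
      have "x a \<in> x ` {..<j}" using that by simp
      moreover have "q b \<notin> x ` {..<j}" using q_mem[OF that(2)] Q(1) by blast
      ultimately show ?thesis by metis
    qed
    show "a = b"
    proof (cases "a < j"; cases "b < j")
      assume "a < j" "b < j"
      then show ?thesis using inj ab by (auto simp: x'_def inj_on_def)
    next
      assume "a < j" "\<not> b < j"
      moreover from this have "b - j < s" using ab by simp
      ultimately show ?thesis using neq[of a "b - j"] ab by (simp add: x'_def)
    next
      assume "\<not> a < j" "b < j"
      moreover from this have "a - j < s" using ab by simp
      ultimately show ?thesis using neq[of b "a - j"] ab by (simp add: x'_def)
    next
      assume *: "\<not> a < j" "\<not> b < j"
      then have "a - j \<in> {..<s}" "b - j \<in> {..<s}" using ab by (simp_all; linarith)+
      moreover have "q (a - j) = q (b - j)" using * ab(3) by (simp add: x'_def)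
      ultimately have "a - j = b - j"
        using q unfolding bij_betw_def by (blast dest: inj_onD)
      with * show ?thesis by linarith
    qed
  qed
  moreover have heights: "\<exists>u \<in> span ((\<lambda>l. x' l - x' 0) ` {..<i}). norm (x' i - x' 0 - u) \<le> h' i"
    if i: "i < j + s" for i
  proof -
    have span_x: "span ((\<lambda>l. x l - x 0) ` {..<i'}) \<subseteq> span ((\<lambda>l. x' l - x' 0) ` {..<i})"
      if "i' \<le> j" "i' \<le> i" for i'
    proof -
      have "(\<lambda>l. x l - x 0) ` {..<i'} = (\<lambda>l. x' l - x' 0) ` {..<i'}"
        using that by (intro image_cong) (simp_all add: x'_def)
      also have "\<dots> \<subseteq> (\<lambda>l. x' l - x' 0) ` {..<i}"
        using that by (intro image_mono) simp
      finally show ?thesis by (rule span_mono)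
    qed
    consider "i < j" | "i = j" | "j < i" by linarith
    then show ?thesis
    proof cases
      case 1
      then obtain u where "u \<in> span ((\<lambda>l. x l - x 0) ` {..<i})" "norm (x i - x 0 - u) \<le> h i"
        using chain by (auto simp: height_chain_def)
      then show ?thesis
        using 1 span_x[of i] by (intro bexI[of _ u]) (auto simp: x'_def h'_def)
    next
      case 2
      have "norm (x' i - x' 0) \<le> 2 * R"
        using P(2)[OF x'_P[of i]] P(2)[OF x'_P[of 0]] i norm_triangle_ineq4[of "x' i" "x' 0"]
        by linarith
      then show ?thesis
        using 2 by (intro bexI[of _ 0]) (auto simp: h'_def span_zero)
    next
      \<comment> \<open>The edge to the first point of the block is now among the earlier edges, so only the
          difference of two points of the block, reduced modulo \<open>U\<close>, counts.\<close>
      case 3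
      then have "i - j < s" "0 < s" using i by auto
      then obtain u where u: "u \<in> U" "norm (q (i - j) - q 0 - u) \<le> \<delta>"
        using Q(3) q_mem by blast
      have "u \<in> span ((\<lambda>l. x' l - x' 0) ` {..<i})"
        using u(1) span_x[of j] 3 unfolding U_def by auto
      moreover have "x' j - x' 0 \<in> span ((\<lambda>l. x' l - x' 0) ` {..<i})"
        using 3 by (intro span_base) simp
      ultimately have mem: "u + (x' j - x' 0) \<in> span ((\<lambda>l. x' l - x' 0) ` {..<i})"
        by (rule span_add)
      have shift: "x' i - x' 0 - (u + (x' j - x' 0)) = q (i - j) - q 0 - u"
        using 3 by (simp add: x'_def)
      have "h' i = \<delta>" using 3 by (simp add: h'_def)
      then have "norm (x' i - x' 0 - (u + (x' j - x' 0))) \<le> h' i"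
        unfolding shift using u(2) by simp
      then show ?thesis using mem by (rule bexI)
    qed
  qed
  ultimately have "height_chain P (j + s) x' h'"
    unfolding height_chain_def using x'_P
  proof (intro conjI allI impI heights)
    show "1 \<le> h' 0" using chain R by (auto simp: h'_def height_chain_def)
  qed auto
  moreover have "(\<Prod>i<j+s. h' i) = (\<Prod>i<j. h i) * (2 * R * \<delta> ^ (s - 1))"
  proof -
    have split: "{..<j+s} = {..<j} \<union> insert j {j<..<j+s}" using s by auto
    have "(\<Prod>i<j+s. h' i) = (\<Prod>i<j. h' i) * (\<Prod>i\<in>insert j {j<..<j+s}. h' i)"
      unfolding split by (intro prod.union_disjoint) auto
    also have "\<dots> = (\<Prod>i<j. h i) * (h' j * (\<Prod>i\<in>{j<..<j+s}. h' i))"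
      by (simp add: h'_def)
    also have "(\<Prod>i\<in>{j<..<j+s}. h' i) = (\<Prod>i\<in>{j<..<j+s}. \<delta>)"
      by (intro prod.cong) (auto simp: h'_def)
    also have "\<dots> = \<delta> ^ (s - 1)" by simp
    finally show ?thesis by (simp add: h'_def)
  qed
  ultimately show ?thesis by (rule that)
qed

text \<open>
  Among any \<open>n\<close> points in general position in the ball of radius \<open>R\<close>, there are \<open>j\<close> points whose heights
  have product \<open>O(n powr (- E))\<close>. The number \<open>k \<ge> j\<close> is that of the vertices finally wanted: it bounds the
  subsets required to be independent and keeps \<open>n\<close> large enough for all blocks.
\<close>
definition chain_exponent :: "'a::euclidean_space itself \<Rightarrow> real \<Rightarrow> nat \<Rightarrow> nat \<Rightarrow> real \<Rightarrow> bool" where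
  "chain_exponent TYPE('a) R k j E \<longleftrightarrow> (\<exists>C>0. \<forall>P::'a set.
     finite P \<and> (\<forall>x\<in>P. norm x < R) \<and> k \<le> card P \<and>
     (\<forall>T\<subseteq>P. card T \<le> k \<longrightarrow> \<not> affine_dependent T) \<longrightarrow>
     (\<exists>x h. height_chain P j x h \<and> (\<Prod>i<j. h i) \<le> C * card P powr (- E)))"

lemma chain_exponent_0:
  assumes "0 < k"
  shows "chain_exponent TYPE('a::euclidean_space) R k 0 0"
  unfolding chain_exponent_def
  using assms by (intro exI[of _ 1]) (auto simp: height_chain_def)

lemma chain_exponent_mono:
  assumes "chain_exponent TYPE('a::euclidean_space) R k j E" "E' \<le> E" "0 < k"
  shows "chain_exponent TYPE('a) R k j E'"
proof -
  obtain C where C: "C > 0" "\<And>P::'a set.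
     finite P \<and> (\<forall>x\<in>P. norm x < R) \<and> k \<le> card P \<and>
     (\<forall>T\<subseteq>P. card T \<le> k \<longrightarrow> \<not> affine_dependent T) \<Longrightarrow>
     (\<exists>x h. height_chain P j x h \<and> (\<Prod>i<j. h i) \<le> C * card P powr (- E))"
    using assms(1) unfolding chain_exponent_def by blast
  have "\<exists>x h. height_chain P j x h \<and> (\<Prod>i<j. h i) \<le> C * card P powr (- E')"
    if P: "finite P \<and> (\<forall>x\<in>P. norm x < R) \<and> k \<le> card P \<and>
      (\<forall>T\<subseteq>P. card T \<le> k \<longrightarrow> \<not> affine_dependent T)" for P :: "'a set"
  proof -
    obtain x h where xh: "height_chain P j x h" "(\<Prod>i<j. h i) \<le> C * card P powr (- E)"
      using C(2)[OF P] by blast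
    have "C * card P powr (- E) \<le> C * card P powr (- E')"
      using P assms(2,3) C(1) by (intro mult_left_mono powr_mono) auto
    with xh show ?thesis by (intro exI conjI) (assumption, linarith)
  qed
  with C(1) show ?thesis
    unfolding chain_exponent_def by (intro exI[of _ C] conjI allI impI)
qed

lemma chain_exponent_step:
  assumes "chain_exponent TYPE('a::euclidean_space) R k j E"
    and R: "1 \<le> R" and k: "k \<le> DIM('a) + 1" and s: "1 \<le> s" "j + s \<le> k"
    and d': "d' = DIM('a) - (j - 1)"
  shows "chain_exponent TYPE('a) R k (j + s) (E + real (s - 1) / real d')"
proof -
  obtain C where C: "C > 0" "\<And>P::'a set.
     finite P \<and> (\<forall>x\<in>P. norm x < R) \<and> k \<le> card P \<and>
     (\<forall>T\<subseteq>P. card T \<le> k \<longrightarrow> \<not> affine_dependent T) \<Longrightarrow>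
     (\<exists>x h. height_chain P j x h \<and> (\<Prod>i<j. h i) \<le> C * card P powr (- E))"
    using assms(1) unfolding chain_exponent_def by blast
  have d'_pos: "d' > 0" using s k DIM_positive[where 'a='a] unfolding d' by linarith
  define a where "a = 4 * R * d' * (s * k) powr (1 / d')"
  have "k > 0" using s by simp
  have a: "a > 0"
    using R d'_pos s \<open>k > 0\<close> by (auto simp: a_def)
  have "\<exists>x h. height_chain P (j + s) x h \<and>
      (\<Prod>i<j+s. h i) \<le> C * (2 * R * a ^ (s - 1)) * card P powr (- (E + real (s - 1) / real d'))"
    if P: "finite P \<and> (\<forall>x\<in>P. norm x < R) \<and> k \<le> card P \<and>
      (\<forall>T\<subseteq>P. card T \<le> k \<longrightarrow> \<not> affine_dependent T)" for P :: "'a set"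
  proof -
    define n where "n = card P"
    have n: "n > 0" "k \<le> n" using P \<open>k > 0\<close> by (auto simp: n_def)
    obtain x h where xh: "height_chain P j x h" "(\<Prod>i<j. h i) \<le> C * n powr (- E)"
      using C(2)[OF P] by (auto simp: n_def)
    define \<delta> where "\<delta> = 4 * R * d' * (s / real (card P - j)) powr (1 / d')"
    obtain x' h' where xh': "height_chain P (j + s) x' h'"
      "(\<Prod>i<j+s. h' i) = (\<Prod>i<j. h i) * (2 * R * \<delta> ^ (s - 1))"
    proof (rule height_chain_extend)
      show "\<delta> = 4 * R * d' * (s / real (card P - j)) powr (1 / d')" by (fact \<delta>_def)
    qed (use P R k s xh(1) d' in auto)
    \<comment> \<open>The \<open>j < k\<close> chosen points cost only a constant factor: at least \<open>n / k\<close> remain.\<close>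
    have "real j * real k \<le> (real k - 1) * real n"
      using s n by (intro mult_mono) auto
    then have "real n \<le> real k * real (n - j)"
      using s n by (simp add: of_nat_diff algebra_simps)
    moreover have "n - j > 0" using s n by simp
    ultimately have "s / real (n - j) \<le> s / (n / k)"
      using n \<open>k > 0\<close> by (intro divide_left_mono) (auto simp: field_simps)
    then have "s / real (n - j) \<le> (s * k) / n" by simp
    then have "(s / real (n - j)) powr (1 / d') \<le> ((s * k) / n) powr (1 / d')"
      by (intro powr_mono2) auto
    also have "\<dots> = (s * k) powr (1 / d') * n powr (- (1 / d'))"
      by (subst powr_divide) (auto simp: powr_minus_divide)
    finally have "\<delta> \<le> a * n powr (- (1 / d'))"
      unfolding \<delta>_def a_def n_def[symmetric] using R d'_pos by (simp add: mult.assoc)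
    then have "\<delta> ^ (s - 1) \<le> (a * n powr (- (1 / d'))) ^ (s - 1)"
      using R d'_pos by (intro power_mono) (auto simp: \<delta>_def)
    also have "\<dots> = a ^ (s - 1) * n powr (- (real (s - 1) / d'))"
      using n by (simp add: power_mult_distrib powr_powr flip: powr_realpow)
    finally have \<delta>_le: "\<delta> ^ (s - 1) \<le> a ^ (s - 1) * n powr (- (real (s - 1) / d'))" .
    have "(\<Prod>i<j+s. h' i) \<le> (C * n powr (- E)) * (2 * R * (a ^ (s - 1) * n powr (- (real (s - 1) / d'))))"
      unfolding xh'(2) using xh(2) \<delta>_le R C(1) d'_pos
      by (intro mult_mono) (auto simp: \<delta>_def)
    also have "\<dots> = C * (2 * R * a ^ (s - 1)) * n powr (- (E + real (s - 1) / d'))"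
      using powr_add[of n "- E" "- (real (s - 1) / d')"] by simp
    finally show ?thesis
      using xh'(1) unfolding n_def by (intro exI conjI) (assumption, linarith)
  qed
  moreover have "C * (2 * R * a ^ (s - 1)) > 0"
    using C(1) R a by simp
  ultimately show ?thesis
    unfolding chain_exponent_def by (intro exI[of _ "C * (2 * R * a ^ (s - 1))"] conjI allI impI)
qed

section \<open>The exponents\<close>

text \<open>
  Numerical upper bounds for logarithms of constants, from \<open>(1 + q / n) ^ n \<le> exp q\<close>: the larger \<open>n\<close>, the
  smaller the loss, so \<open>n\<close> is taken large enough for the bound at hand.
\<close>
lemma ln_le_if_le_power:
  fixes y q :: real
  assumes "0 < y" "0 \<le> q" "0 < n" "y \<le> (1 + q / real n) ^ n"
  shows "ln y \<le> q"
proof -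
  have "y \<le> exp q"
    using assms exp_ge_one_plus_x_over_n_power_n[of n q] by linarith
  then show ?thesis using assms(1) by (metis exp_gt_zero ln_exp ln_le_cancel_iff)
qed

text \<open>
  The quadratic Taylor bound \<open>1 + 4 * x + 8 * x\<^sup>2\<close> for \<open>exp (4 * x)\<close> is too weak at \<open>x = 1 / 7\<close>. The
  square of the one for \<open>exp (2 * x)\<close> suffices, and similarly its cube for \<open>exp (6 * x)\<close> at \<open>x = 1 / 6\<close>.
\<close>
lemma exp_ge_quadratic_power:
  fixes x :: real
  assumes "0 \<le> x"
  shows "(1 + 2 * x + 2 * x\<^sup>2) ^ n \<le> exp (2 * real n * x)"
proof -
  have "1 + 2 * x + 2 * x\<^sup>2 \<le> exp (2 * x)"
    using exp_lower_Taylor_quadratic[of "2 * x"] assms by (simp add: power2_eq_square)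
  then have "(1 + 2 * x + 2 * x\<^sup>2) ^ n \<le> exp (2 * x) ^ n"
    using assms by (intro power_mono) auto
  then show ?thesis
    by (simp add: exp_of_nat_mult[symmetric] mult.commute mult.left_commute)
qed

text \<open>
  In terms of \<open>x = 1 / D\<close> this is \<open>1 / (1 - 3 * x) \<le> exp (4 * x)\<close>. Replacing the exponential by its lower bound
  leaves a polynomial inequality, in which the first-order terms favour the right-hand side; the worst
  case is the end point \<open>x = 1 / 7\<close>. At \<open>D = 6\<close>, where the claim reads \<open>ln 2 \<le> 2 / 3\<close>, it fails.
\<close>
lemma ln_three_block_le:
  assumes "7 \<le> D"
  shows "ln (real D / (real D - 3)) \<le> 4 / real D"
proof -
  define x where "x = 1 / real D"
  have x: "0 < x" "x \<le> 1/7" using assms by (auto simp: x_def field_simps)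
  have x2: "x * x \<le> (1/7) * (1/7)" using x by (intro mult_mono) auto
  have x3: "x * (x * x) \<le> (1/7) * ((1/7) * (1/7))" using x x2 by (intro mult_mono) auto
  have x4: "x * (x * (x * x)) \<le> (1/7) * ((1/7) * ((1/7) * (1/7)))" using x x3 by (intro mult_mono) auto
  have "0 \<le> x * (1 - 4 * x - 16 * (x * x) - 20 * (x * (x * x)) - 12 * (x * (x * (x * x))))"
    using x x2 x3 x4 by (intro mult_nonneg_nonneg) linarith+
  also have "\<dots> = (1 + 2 * x + 2 * x\<^sup>2) ^ 2 * (1 - 3 * x) - 1"
    by (simp add: algebra_simps power2_eq_square)
  finally have "1 / (1 - 3 * x) \<le> (1 + 2 * x + 2 * x\<^sup>2) ^ 2"
    using x by (simp add: divide_le_eq)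
  also have "\<dots> \<le> exp (4 * x)"
    using exp_ge_quadratic_power[of x 2] x by simp
  also have "1 / (1 - 3 * x) = real D / (real D - 3)"
    using assms by (simp add: x_def field_simps)
  finally have "ln (real D / (real D - 3)) \<le> ln (exp (4 * x))"
    using assms by (subst ln_le_cancel_iff) auto
  then show ?thesis by (simp add: x_def)
qed

text \<open>
  The same argument for \<open>(1 + 2 * x) / (1 - 3 * x) \<le> exp (6 * x)\<close> with \<open>x = 1 / d\<close>; the numerator comes from the
  \<open>d + 2\<close> in the exponent to be proved.
\<close>
lemma ln_initial_block_le:
  assumes "6 \<le> d"
  shows "ln ((real d + 2) / (real d - 3)) \<le> 6 / real d"
proof -
  define x where "x = 1 / real d"
  have x: "0 < x" "x \<le> 1/6" using assms by (auto simp: x_def field_simps)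
  have x2: "x * x \<le> (1/6) * (1/6)" using x by (intro mult_mono) auto
  have x3: "x * (x * x) \<le> (1/6) * ((1/6) * (1/6))" using x x2 by (intro mult_mono) auto
  have x4: "x * (x * (x * x)) \<le> (1/6) * ((1/6) * ((1/6) * (1/6)))" using x x3 by (intro mult_mono) auto
  have x5: "x * (x * (x * (x * x))) \<le> (1/6) * ((1/6) * ((1/6) * ((1/6) * (1/6))))" using x x4 by (intro mult_mono) auto
  have x6: "x * (x * (x * (x * (x * x)))) \<le> (1/6) * ((1/6) * ((1/6) * ((1/6) * ((1/6) * (1/6)))))" using x x5 by (intro mult_mono) auto
  have "0 \<le> x * (1 - 22 * (x * x) - 60 * (x * (x * x)) - 84 * (x * (x * (x * x)))
      - 64 * (x * (x * (x * (x * x)))) - 24 * (x * (x * (x * (x * (x * x))))))"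
    using x x2 x3 x4 x5 x6 by (intro mult_nonneg_nonneg) linarith+
  also have "\<dots> = (1 + 2 * x + 2 * x\<^sup>2) ^ 3 * (1 - 3 * x) - (1 + 2 * x)"
    by (simp add: algebra_simps power2_eq_square power3_eq_cube)
  finally have "(1 + 2 * x) / (1 - 3 * x) \<le> (1 + 2 * x + 2 * x\<^sup>2) ^ 3"
    using x by (simp add: divide_le_eq)
  also have "\<dots> \<le> exp (6 * x)"
    using exp_ge_quadratic_power[of x 3] x by simp
  also have "(1 + 2 * x) / (1 - 3 * x) = (real d + 2) / (real d - 3)"
    using assms by (simp add: x_def field_simps)
  finally have "ln ((real d + 2) / (real d - 3)) \<le> ln (exp (6 * x))"
    using assms by (subst ln_le_cancel_iff) auto
  then show ?thesis by (simp add: x_def)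
qed

text \<open>
  These cases, in which one block of all \<open>r\<close> missing vertices at free dimension \<open>D\<close> gains at least
  \<open>1/2 * ln (D / (D - r + 1))\<close>, are ends of the recursion below, where a block of three leaves nothing to
  fill or gains too little.
\<close>
lemma ln_single_block_le:
  assumes r: "1 \<le> r" "r \<le> D" and small: "r \<le> 3 \<or> D \<le> 6 \<and> r = 4 \<or> D = 6 \<and> r = 5"
  shows "ln (real D / (real D - real r + 1)) \<le> 2 * (real r - 1) / real D"
proof -
  consider "r = 1" | "r = 2" | "r = 3" "D = 3" | "r = 3" "4 \<le> D"
    | "r = 4" "D = 4" | "r = 4" "D = 5" | "r = 4" "D = 6" | "r = 5" "D = 6"
    using assms by linarith
  then show ?thesis
  proof cases
    case 1
    then show ?thesis using r by simp
  next
    case 2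
    have "ln (real D / (real D - 1)) \<le> real D / (real D - 1) - 1"
      using 2 r by (intro ln_le_minus_one) auto
    also have "\<dots> \<le> 2 / real D"
      using 2 r by (simp add: field_simps)
    finally show ?thesis using 2 by simp
  next
    case 3
    have "ln (3::real) \<le> 4/3"
      by (rule ln_le_if_le_power[where n = 4]) (simp_all add: power_divide)
    with 3 show ?thesis by simp
  next
    case 4
    have "ln (real D / (real D - 2)) \<le> real D / (real D - 2) - 1"
      using 4 by (intro ln_le_minus_one) auto
    also have "\<dots> \<le> 4 / real D"
      using 4 by (simp add: field_simps)
    finally show ?thesis using 4 by simp
  next
    case 5
    have "ln (4::real) \<le> 3/2"
      by (rule ln_le_if_le_power[where n = 12]) (simp_all add: power_divide)
    with 5 show ?thesis by simp
  next
    case 6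
    have "ln (5/2::real) \<le> 6/5"
      by (rule ln_le_if_le_power[where n = 4]) (simp_all add: power_divide)
    with 6 show ?thesis by simp
  next
    case 7
    have "ln (2::real) \<le> 1"
      by (rule ln_le_if_le_power[where n = 1]) simp_all
    with 7 show ?thesis by simp
  next
    case 8
    have "ln (3::real) \<le> 4/3"
      by (rule ln_le_if_le_power[where n = 4]) (simp_all add: power_divide)
    with 8 show ?thesis by simp
  qed
qed

lemma ln_divide_split:
  fixes a b c :: real
  assumes "0 < a" "0 < b" "0 < c"
  shows "ln (a / c) = ln (a / b) + ln (b / c)"
  using assms by (simp add: ln_div)

text \<open>
  Completes a nonempty chain of \<open>j\<close> vertices to \<open>k\<close> vertices. With \<open>D\<close> the current free dimension and \<open>r\<close> the number of
  missing vertices, the gain is \<open>1/2 * ln (D / (D - r + 1))\<close>. A block of three keeps \<open>D - r\<close> fixed, so the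
  gains telescope. The value for \<open>r = 1\<close> is \<open>0\<close>, as it must be, because a block of one point gains nothing.
\<close>
lemma chain_exponent_fill:
  assumes "chain_exponent TYPE('a::euclidean_space) R k j E"
    and R: "1 \<le> R" and k: "k \<le> DIM('a) + 1" and "1 \<le> j" "j < k"
  shows "chain_exponent TYPE('a) R k k
    (E + 1/2 * ln ((real DIM('a) - real j + 1) / (real DIM('a) - real k + 2)))"
  using assms(1,4,5)
proof (induction "k - j" arbitrary: j E rule: less_induct)
  case less
  define D where "D = DIM('a) - (j - 1)"
  define r where "r = k - j"
  have r: "1 \<le> r" "r \<le> D" "j + r = k" and real_r: "real r = real k - real j"
    and D: "real D = real DIM('a) - real j + 1"
    using less.prems k by (auto simp: r_def D_def of_nat_diff)
  let ?goal = "E + 1/2 * ln (real D / (real D - real r + 1))"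
  have goal: "E + 1/2 * ln ((real DIM('a) - real j + 1) / (real DIM('a) - real k + 2)) = ?goal"
    unfolding D real_r by (simp add: algebra_simps)
  have step: "chain_exponent TYPE('a) R k (j + s) (E + real (s - 1) / real D)"
    if "1 \<le> s" "s \<le> r" for s
    using chain_exponent_step[OF less.prems(1) R k _ _ D_def] that r by auto
  \<comment> \<open>A single block of 5 at \<open>D = 5\<close>, or of 6 at \<open>D = 6\<close>, is not enough; a block of two before the
      final one makes up for it.\<close>
  consider "r \<le> 3 \<or> D \<le> 6 \<and> r = 4 \<or> D = 6 \<and> r = 5" | "4 \<le> r" "7 \<le> D"
    | "D = 5 \<and> r = 5 \<or> D = 6 \<and> r = 6"
    using r(2) by linarith
  then show ?case
    unfolding goal
  proof cases
    case 1
    have "chain_exponent TYPE('a) R k (j + r) ?goal"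
      using ln_single_block_le[OF r(1,2) 1] r less.prems
      by (intro chain_exponent_mono[OF step[of r]]) (auto simp: of_nat_diff mult.commute)
    then show "chain_exponent TYPE('a) R k k ?goal" using r by simp
  next
    case 2
    have "chain_exponent TYPE('a) R k (j + 3) (E + 2 / real D)"
      using step[of 3] 2 by simp
    then have "chain_exponent TYPE('a) R k k
        (E + 2 / real D + 1/2 * ln ((real DIM('a) - real (j + 3) + 1) / (real DIM('a) - real k + 2)))"
      using 2 r less.prems by (intro less.hyps) auto
    moreover have "(real DIM('a) - real (j + 3) + 1) / (real DIM('a) - real k + 2)
        = (real D - 3) / (real D - real r + 1)"
      unfolding D real_r by (simp add: algebra_simps)
    moreover have "ln (real D / (real D - real r + 1)) =
        ln (real D / (real D - 3)) + ln ((real D - 3) / (real D - real r + 1))"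
      using 2 r(2) by (intro ln_divide_split) auto
    ultimately show "chain_exponent TYPE('a) R k k ?goal"
      using ln_three_block_le[OF 2(2)] less.prems by (elim chain_exponent_mono) auto
  next
    case 3
    have "chain_exponent TYPE('a) R k (j + 2) (E + 1 / real D)"
      using step[of 2] 3 by auto
    moreover have "D - 2 = DIM('a) - (j + 2 - 1)"
      using less.prems by (simp add: D_def)
    ultimately have two: "chain_exponent TYPE('a) R k (j + 2 + (r - 2))
        (E + 1 / real D + real (r - 2 - 1) / real (D - 2))"
      using 3 r by (intro chain_exponent_step R k) auto
    have "ln (5::real) \<le> 26/15"
      by (rule ln_le_if_le_power[where n = 12]) (simp_all add: power_divide)
    moreover have "ln (6::real) \<le> 11/6"
      by (rule ln_le_if_le_power[where n = 60]) (simp_all add: power_divide)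
    ultimately have "?goal \<le> E + 1 / real D + real (r - 2 - 1) / real (D - 2)"
      using 3 by auto
    then have "chain_exponent TYPE('a) R k (j + 2 + (r - 2)) ?goal"
      using less.prems by (intro chain_exponent_mono[OF two]) auto
    moreover have "j + 2 + (r - 2) = k" using 3 r by auto
    ultimately show "chain_exponent TYPE('a) R k k ?goal" by simp
  qed
qed

lemma ln_initial_single_block_le:
  assumes d: "3 \<le> d" and k: "2 \<le> k" "k \<le> d + 1" and small: "d \<le> 5 \<or> k \<le> 4"
  shows "ln ((real d + 2) / (real d - real k + 2)) \<le> 2 * (real k - 1) / real d"
proof -
  consider "k = 2" | "k = 3" "d = 3" | "k = 3" "4 \<le> d"
    | "k = 4" "d = 3" | "k = 4" "d = 4" | "k = 4" "d = 5" | "k = 4" "6 \<le> d"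
    | "k = 5" "d = 4" | "k = 5" "d = 5" | "k = 6" "d = 5"
    using assms by atomize_elim arith
  then show ?thesis
  proof cases
    case 1
    have "ln ((real d + 2) / real d) \<le> (real d + 2) / real d - 1"
      using d by (intro ln_le_minus_one) auto
    also have "\<dots> = 2 / real d"
      using d by (simp add: field_simps)
    finally show ?thesis using 1 by simp
  next
    case 2
    have "ln (5/2::real) \<le> 4/3"
      by (rule ln_le_if_le_power[where n = 4]) (simp_all add: power_divide)
    with 2 show ?thesis by simp
  next
    case 3
    have "ln ((real d + 2) / (real d - 1)) \<le> (real d + 2) / (real d - 1) - 1"
      using 3 by (intro ln_le_minus_one) auto
    also have "\<dots> \<le> 4 / real d"
      using 3 by (simp add: field_simps)
    finally show ?thesis using 3 by simp
  next
    case 4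
    have "ln (5::real) \<le> 2"
      by (rule ln_le_if_le_power[where n = 4]) (simp_all add: power_divide)
    with 4 show ?thesis by simp
  next
    case 5
    have "ln (3::real) \<le> 3/2"
      by (rule ln_le_if_le_power[where n = 4]) (simp_all add: power_divide)
    with 5 show ?thesis by simp
  next
    case 6
    have "ln (7/3::real) \<le> 6/5"
      by (rule ln_le_if_le_power[where n = 4]) (simp_all add: power_divide)
    with 6 show ?thesis by simp
  next
    case 7
    have "ln ((real d + 2) / (real d - 2)) \<le> (real d + 2) / (real d - 2) - 1"
      using 7 by (intro ln_le_minus_one) auto
    also have "\<dots> \<le> 6 / real d"
      using 7 by (simp add: field_simps)
    finally show ?thesis using 7 by simp
  next
    case 8
    have "ln (6::real) \<le> 2"
      by (rule ln_le_if_le_power[where n = 12]) (simp_all add: power_divide)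
    with 8 show ?thesis by simp
  next
    case 9
    have "ln (7/2::real) \<le> 8/5"
      by (rule ln_le_if_le_power[where n = 4]) (simp_all add: power_divide)
    with 9 show ?thesis by simp
  next
    case 10
    have "ln (7::real) \<le> 2"
      by (rule ln_le_if_le_power[where n = 60]) (simp_all add: power_divide)
    with 10 show ?thesis by simp
  qed
qed

text \<open>
  A first block of four followed by \<open>chain_exponent_fill\<close> requires \<open>k > 4\<close>, since only a nonempty rest can be filled,
  and \<open>d \<ge> 6\<close> for the estimate of its gain. All other cases are covered by a single block.
\<close>
lemma chain_exponent_full:
  assumes R: "1 \<le> R" and d: "3 \<le> DIM('a::euclidean_space)" and k: "2 \<le> k" "k \<le> DIM('a) + 1"
  shows "chain_exponent TYPE('a) R k k (1/2 * ln ((real DIM('a) + 2) / (real DIM('a) - real k + 2)))"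
    (is "chain_exponent _ _ _ _ ?goal")
proof -
  have initial: "chain_exponent TYPE('a) R k s (real (s - 1) / real DIM('a))" if "1 \<le> s" "s \<le> k" for s
    using chain_exponent_step[OF chain_exponent_0 R k(2) that(1), where d' = "DIM('a)"] that by simp
  show ?thesis
  proof (cases "DIM('a) \<le> 5 \<or> k \<le> 4")
    case True
    then show ?thesis
      using ln_initial_single_block_le[OF d k] k
      by (intro chain_exponent_mono[OF initial[of k]]) (auto simp: of_nat_diff mult.commute)
  next
    case False
    then have "chain_exponent TYPE('a) R k 4 (3 / real DIM('a))"
      using initial[of 4] by simp
    then have "chain_exponent TYPE('a) R k k
        (3 / real DIM('a) + 1/2 * ln ((real DIM('a) - real 4 + 1) / (real DIM('a) - real k + 2)))"
      using False k R by (intro chain_exponent_fill) auto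
    moreover have "ln ((real DIM('a) + 2) / (real DIM('a) - real k + 2)) =
        ln ((real DIM('a) + 2) / (real DIM('a) - 3)) + ln ((real DIM('a) - 3) / (real DIM('a) - real k + 2))"
      using False k by (intro ln_divide_split) auto
    ultimately show ?thesis
      using ln_initial_block_le[of "DIM('a)"] False k by (elim chain_exponent_mono) auto
  qed
qed

section \<open>Volumes of chains and of degenerate simplices\<close>

text \<open>
  Enumerate \<open>S\<close> such that the vertex in the affine hull of the others comes last. Then the last height
  is \<open>0\<close>.
\<close>
lemma flat_volume_affine_dependent_le_0:
  fixes S :: "(real ^ 'n) set"
  assumes card: "card S = Suc m" and m: "m \<le> CARD('n)" and dep: "affine_dependent S"
  shows "flat_volume m (convex hull S) \<le> 0"
proof -
  have "finite S" using card by (simp add: card_ge_0_finite)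
  obtain y where y: "y \<in> S" "y \<in> affine hull (S - {y})"
    using dep by (auto simp: affine_dependent_def)
  then have "S - {y} \<noteq> {}" by (metis affine_hull_empty empty_iff)
  moreover have card_Sy: "card (S - {y}) = m" using card y \<open>finite S\<close> by simp
  ultimately obtain m' where m': "m = Suc m'"
    using \<open>finite S\<close> by (metis card_0_eq finite_Diff not0_implies_Suc)
  obtain x0 where x0: "bij_betw x0 {..<m} (S - {y})"
    using ex_bij_betw_nat_finite[of "S - {y}"] \<open>finite S\<close> card_Sy by (auto simp: atLeast0LessThan)
  define x where "x = x0(m := y)"
  have x_less: "x ` {..<m} = S - {y}"
    using x0 by (auto simp: x_def bij_betw_def)
  then have x_img: "x ` {..m} = S"
    using y by (auto simp: x_def lessThan_Suc_atMost[symmetric] lessThan_Suc)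
  have "x ` {..<m} = insert (x 0) ((\<lambda>l. x (Suc l)) ` {..<m'})"
    unfolding m' lessThan_Suc_eq_insert_0 by (simp add: image_image)
  then have "y \<in> (\<lambda>z. x 0 + z) ` span ((\<lambda>z. - x 0 + z) ` (\<lambda>l. x (Suc l)) ` {..<m'})"
    using y(2) x_less by (metis affine_hull_insert_span_gen)
  then obtain z where "z \<in> span ((\<lambda>z. - x 0 + z) ` (\<lambda>l. x (Suc l)) ` {..<m'})" "y = x 0 + z"
    by blast
  moreover have "(\<lambda>z. - x 0 + z) ` (\<lambda>l. x (Suc l)) ` {..<m'} = (\<lambda>l. x (Suc l) - x 0) ` {..<m'}"
    unfolding image_image by (intro image_cong) auto
  moreover have "x m = y" by (simp add: x_def)
  ultimately have y_span: "x m - x 0 \<in> span ((\<lambda>l. x (Suc l) - x 0) ` {..<m'})"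
    by simp
  have "flat_volume m (convex hull (x ` {..m})) \<le>
      (\<Prod>i<m. if i = m' then 0 else norm (x (Suc i) - x 0))"
  proof (rule flat_volume_simplex_le_prod_heights[OF m])
    fix i assume "i < m"
    show "\<exists>u\<in>span ((\<lambda>l. x (Suc l) - x 0) ` {..<i}). norm (x (Suc i) - x 0 - u)
        \<le> (if i = m' then 0 else norm (x (Suc i) - x 0))"
    proof (cases "i = m'")
      case True
      then show ?thesis using y_span m' by (intro bexI[of _ "x m - x 0"]) auto
    next
      case False
      then show ?thesis by (intro bexI[of _ 0]) (auto simp: span_zero)
    qed
  qed
  also have "\<dots> = 0"
    using m' by (intro prod_zero) auto
  finally show ?thesis unfolding x_img .
qed

lemma flat_volume_height_chain_le:
  fixes P :: "(real ^ 'n) set"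
  assumes m: "m \<le> CARD('n)" and chain: "height_chain P (Suc m) x h"
  shows "flat_volume m (convex hull (x ` {..m})) \<le> (\<Prod>i<Suc m. h i)"
proof -
  have h: "\<exists>u \<in> span ((\<lambda>l. x (Suc l) - x 0) ` {..<i}). norm (x (Suc i) - x 0 - u) \<le> h (Suc i)"
    if "i < m" for i
  proof -
    have "(\<lambda>l. x l - x 0) ` {..<Suc i} = insert 0 ((\<lambda>l. x (Suc l) - x 0) ` {..<i})"
      unfolding lessThan_Suc_eq_insert_0 by (simp add: image_image)
    then show ?thesis
      using chain that unfolding height_chain_def by (metis Suc_less_eq span_insert_0)
  qed
  have h_nonneg: "0 \<le> h (Suc i)" if "i < m" for i
    using h[OF that] by (meson norm_ge_zero order_trans)
  have "flat_volume m (convex hull (x ` {..m})) \<le> (\<Prod>i<m. h (Suc i))"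
    by (rule flat_volume_simplex_le_prod_heights[OF m h])
  also have "\<dots> \<le> h 0 * (\<Prod>i<m. h (Suc i))"
  proof -
    have "1 \<le> h 0" using chain by (simp add: height_chain_def)
    moreover have "0 \<le> (\<Prod>i<m. h (Suc i))" using h_nonneg by (intro prod_nonneg) auto
    ultimately show ?thesis using mult_right_mono[of 1 "h 0" "\<Prod>i<m. h (Suc i)"] by simp
  qed
  also have "\<dots> = (\<Prod>i<Suc m. h i)"
    by (rule prod.lessThan_Suc_shift[symmetric])
  finally show ?thesis .
qed

lemma Delta_le:
  assumes "0 < B"
    and "\<And>P :: (real ^ 'd::finite) set. P \<subseteq> cbox 0 1 \<Longrightarrow> card P = n \<Longrightarrow>
      \<exists>S \<subseteq> P. card S = k \<and> flat_volume (k - 1) (convex hull S) \<le> B"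
  shows "Delta TYPE('d) k n \<le> B"
  unfolding Delta_def using assms
  by (intro cInf_lower) (auto intro!: bdd_belowI[of _ 0])

theorem corollary1p4:
  fixes d k :: nat
  assumes "CARD('d::finite) = d" and "d \<ge> 3" and "2 \<le> k" and "k \<le> d + 1"
  shows "\<exists>C::real. C > 0 \<and> (\<forall>n::nat. n \<ge> k \<longrightarrow>
    Delta TYPE('d) k n
      \<le> C * real n powr (- (1 / 2) * ln ((real d + 2) / (real d - real k + 2))))"
proof -
  define E where "E = 1/2 * ln ((real d + 2) / (real d - real k + 2))"
  define R where "R = real d + 1"
  obtain m where m: "k = Suc m" using assms(3) by (cases k) auto
  have m_le: "m \<le> CARD('d)" using m assms by simp
  have "chain_exponent TYPE(real ^ 'd) R k k E"
    using chain_exponent_full[of R k, where 'a = "real ^ 'd"] assms by (simp add: E_def R_def)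
  then obtain C where C: "C > 0" "\<And>P :: (real ^ 'd) set.
     finite P \<and> (\<forall>x\<in>P. norm x < R) \<and> k \<le> card P \<and>
     (\<forall>T\<subseteq>P. card T \<le> k \<longrightarrow> \<not> affine_dependent T) \<Longrightarrow>
     (\<exists>x h. height_chain P k x h \<and> (\<Prod>i<k. h i) \<le> C * card P powr (- E))"
    unfolding chain_exponent_def by blast
  have "Delta TYPE('d) k n \<le> C * real n powr (- E)" if n: "k \<le> n" for n
  proof (rule Delta_le)
    have "0 < n" using n m by simp
    then show B_pos: "0 < C * real n powr (- E)" using C(1) by simp
    fix P :: "(real ^ 'd) set" assume P: "P \<subseteq> cbox 0 1" "card P = n"
    have "finite P" using P(2) \<open>0 < n\<close> card_ge_0_finite by blast
    show "\<exists>S \<subseteq> P. card S = k \<and> flat_volume (k - 1) (convex hull S) \<le> C * real n powr (- E)"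
    proof (cases "\<forall>T\<subseteq>P. card T \<le> k \<longrightarrow> \<not> affine_dependent T")
      case True
      have "norm x < R" if "x \<in> P" for x
      proof -
        have "x \<in> cbox 0 1" using that P(1) by blast
        then have "norm x \<le> (\<Sum>i\<in>(UNIV :: 'd set). 1)"
          using norm_le_l1_cart[of x] sum_mono[of UNIV "\<lambda>i. \<bar>x $ i\<bar>" "\<lambda>_. 1"]
          by (simp add: mem_box_cart)
        then show ?thesis using assms(1) by (simp add: R_def)
      qed
      with True P n \<open>finite P\<close> obtain x h where chain: "height_chain P k x h"
        and h: "(\<Prod>i<k. h i) \<le> C * real n powr (- E)"
        using C(2)[of P] by auto
      have "flat_volume m (convex hull (x ` {..m})) \<le> (\<Prod>i<k. h i)"
        using flat_volume_height_chain_le[OF m_le] chain unfolding m by blast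
      moreover have "{..m} = {..<k}" using m by (simp add: lessThan_Suc_atMost)
      moreover have "x ` {..<k} \<subseteq> P" "card (x ` {..<k}) = k"
        using chain by (auto simp: height_chain_def card_image)
      ultimately show ?thesis
        using h m by (intro exI[of _ "x ` {..<k}"]) auto
    next
      case False
      then obtain T where T: "T \<subseteq> P" "card T \<le> k" "affine_dependent T" by blast
      then obtain S where S: "T \<subseteq> S" "S \<subseteq> P" "card S = k"
        using exists_subset_between[of T k P] n P \<open>finite P\<close> by auto
      then have "affine_dependent S" using T(3) affine_independent_subset by blast
      then have "flat_volume m (convex hull S) \<le> 0"
        using S m m_le by (intro flat_volume_affine_dependent_le_0) auto
      with S m B_pos show ?thesis by (intro exI[of _ S]) auto
    qed
  qed
  with C(1) show ?thesis
    by (intro exI[of _ C]) (simp add: E_def)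
qed

end
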